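(* Let $c_5(n)$ be defined by $$\sum_{n=0}^\infty c_5(n)q^n=\frac{1}{\Psi(-q^5,q)},\qquad \Psi(a,b):=\sum_{n=0}^\infty a^{n(n+1)/2} b^{n(n-1)/2}-\sum_{n=-\infty}^{-1} a^{n(n+1)/2}b^{n(n-1)/2}.$$ Let $p\equiv 7\pmod 8$ be a prime. Then for all integers $n$ and $k\ge 0$ with $p\nmid n$, $$c_5\!\left(4p^{2k+1}n+\frac{8p^{2k+2}+1}{3}\right)\equiv 0\pmod 4.$$
   Context: $q$ is a complex variable with $|q|<1$ (equivalently, work with formal power series). Explicitly, $\Psi(-q^5,q)=\sum_{n\ge0}(-1)^{n(n+1)/2}q^{3n^2+2n}-\sum_{n\le -1}(-1)^{n(n+1)/2}q^{3n^2+2n}$, a power series with constant term $1$. The convention $c_5(m)=0$ for $m<0$ is used. *)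

theory Defs
  imports
    "HOL-Analysis.Infinite_Sum"
    "HOL-Computational_Algebra.Formal_Power_Series"
    "HOL-Number_Theory.Cong"
begin

text \<open>
  The false theta function, for formal power series \<open>a\<close> and \<open>b\<close>. The infinite sums are taken in
  the \<open>X\<close>-adic topology on formal power series. The exponents are triangular numbers, so
  the integer divisions are exact and \<^const>\<open>nat\<close> never truncates.
\<close>

definition Psi :: "'a::comm_ring_1 fps \<Rightarrow> 'a fps \<Rightarrow> 'a fps" where
  "Psi a b =
     (\<Sum>\<^sub>\<infinity>n\<in>{0::int..}. a ^ nat (n * (n + 1) div 2) * b ^ nat (n * (n - 1) div 2)) -
     (\<Sum>\<^sub>\<infinity>n\<in>{..-1::int}. a ^ nat (n * (n + 1) div 2) * b ^ nat (n * (n - 1) div 2))"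

text \<open>
  The coefficients of \<open>1 / \<Psi>(-q\<^sup>5, q)\<close>. The reciprocal is taken in the ring of integer power
  series, so that congruences make sense; \<open>fps_right_inverse F 1\<close> is the reciprocal of \<open>F\<close> when
  \<open>F\<close> has constant term \<open>1\<close>, which is the case here. See \<open>c5_generating_function\<close> below, and
  \<open>c5_generating_function_complex\<close> for the quotient over the complex numbers.
\<close>

definition c5 :: "int \<Rightarrow> int" where
  "c5 m = (if m < 0 then 0
           else fps_nth (fps_right_inverse (Psi (- (fps_X ^ 5)) fps_X) 1) (nat m))"

lemma Psi_term_nth:
  "fps_nth ((- (fps_X ^ 5)) ^ nat (n * (n + 1) div 2) *
      (fps_X :: 'a::comm_ring_1 fps) ^ nat (n * (n - 1) div 2)) k =
   (if int k = 3 * n^2 + 2 * n then (-1) ^ nat (n * (n + 1) div 2) else 0)"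
proof -
  define s where "s = nat (n * (n + 1) div 2)"
  define t where "t = nat (n * (n - 1) div 2)"
  have nn: "n * (n + 1) \<ge> 0" "n * (n - 1) \<ge> 0"
    by (cases "n \<ge> 0"; cases "n = 0"; simp add: zero_le_mult_iff)+
  have s: "2 * int s = n * (n + 1)" and t: "2 * int t = n * (n - 1)"
    using nn by (simp_all add: s_def t_def)
  have e: "int (5 * s + t) = 3 * n^2 + 2 * n"
    using s t by (simp add: algebra_simps power2_eq_square)
  have "fps_const ((-1) ^ s) = ((-1) ^ s :: 'a fps)"
    by (metis fps_const_power fps_const_neg fps_const_1_eq_1)
  hence "(- (fps_X ^ 5)) ^ s * (fps_X :: 'a fps) ^ t = fps_const ((-1) ^ s) * fps_X ^ (5 * s + t)"
    unfolding power_minus[of "fps_X ^ 5"] power_add power_mult by (simp only: mult.assoc)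
  moreover have "k = 5 * s + t \<longleftrightarrow> int k = 3 * n^2 + 2 * n"
    using e by linarith
  ultimately show ?thesis
    by (simp add: s_def [symmetric] t_def [symmetric])
qed

lemma Psi_exponent_finite: "finite {n::int. int k = 3 * n^2 + 2 * n}"
proof (rule finite_subset)
  show "{n::int. int k = 3 * n^2 + 2 * n} \<subseteq> {- int k - 1..int k}"
  proof
    fix n :: int assume "n \<in> {n. int k = 3 * n^2 + 2 * n}"
    hence k: "int k = 3 * n^2 + 2 * n" by simp
    have "\<bar>n\<bar> * 1 \<le> \<bar>n\<bar> * \<bar>n\<bar>"
      by (cases "n = 0") (simp, rule mult_left_mono, auto)
    hence "n^2 \<ge> \<bar>n\<bar>" by (simp add: power2_eq_square)
    thus "n \<in> {- int k - 1..int k}" using k by auto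
  qed
qed auto

text \<open>Both sums in \<open>\<Psi>(-q\<^sup>5, q)\<close> converge.\<close>

lemma Psi_has_sum:
  defines "f \<equiv> \<lambda>n::int. (- (fps_X ^ 5)) ^ nat (n * (n + 1) div 2) *
      (fps_X :: 'a::comm_ring_1 fps) ^ nat (n * (n - 1) div 2)"
  shows "(f has_sum Abs_fps (\<lambda>k. \<Sum>n | n \<in> A \<and> int k = 3 * n^2 + 2 * n.
            (-1) ^ nat (n * (n + 1) div 2))) A"
proof (rule has_sum_fpsI)
  fix k
  show "finite {x \<in> A. fps_nth (f x) k \<noteq> 0}"
    by (rule finite_subset[OF _ Psi_exponent_finite[of k]])
       (auto simp: f_def Psi_term_nth split: if_splits)
  show "fps_nth (Abs_fps (\<lambda>k. \<Sum>n | n \<in> A \<and> int k = 3 * n^2 + 2 * n.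
            (-1) ^ nat (n * (n + 1) div 2))) k =
         (\<Sum>x | x \<in> A \<and> fps_nth (f x) k \<noteq> 0. fps_nth (f x) k)"
    unfolding fps_nth_Abs_fps
    by (rule sum.mono_neutral_cong)
       (auto simp: f_def Psi_term_nth intro: finite_subset[OF _ Psi_exponent_finite[of k]] split: if_splits)
qed

lemma Psi_nth:
  "fps_nth (Psi (- (fps_X ^ 5)) (fps_X :: 'a::comm_ring_1 fps)) k =
     (\<Sum>n | n \<ge> 0 \<and> int k = 3 * n^2 + 2 * n. (-1) ^ nat (n * (n + 1) div 2)) -
     (\<Sum>n | n \<le> -1 \<and> int k = 3 * n^2 + 2 * n. (-1) ^ nat (n * (n + 1) div 2))"
  unfolding Psi_def infsumI[OF Psi_has_sum] by simp

lemma Psi_nth_0: "fps_nth (Psi (- (fps_X ^ 5)) (fps_X :: 'a::comm_ring_1 fps)) 0 = 1"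
proof -
  have zero: "int 0 = 3 * n^2 + 2 * n \<longleftrightarrow> n = 0" for n :: int
  proof
    assume "int 0 = 3 * n^2 + 2 * n"
    hence *: "n * (3 * n + 2) = 0" by (simp add: algebra_simps power2_eq_square)
    have "3 * n + 2 \<noteq> 0" by presburger
    with * show "n = 0" by simp
  qed simp
  have e: "{n::int. n \<ge> 0 \<and> n = 0} = {0}" "{n::int. n \<le> -1 \<and> n = 0} = {}"
    by auto
  show ?thesis unfolding Psi_nth zero e by simp
qed

lemma c5_generating_function:
  "Abs_fps (\<lambda>n. c5 (int n)) * Psi (- (fps_X ^ 5)) fps_X = 1"
proof -
  have "Abs_fps (\<lambda>n. c5 (int n)) = fps_right_inverse (Psi (- (fps_X ^ 5)) fps_X) 1"
    by (rule fps_ext) (simp add: c5_def)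
  thus ?thesis
    using fps_right_inverse[of "Psi (- (fps_X ^ 5)) (fps_X :: int fps)" 1]
    by (simp add: Psi_nth_0 mult.commute)
qed

lemma c5_generating_function_complex:
  "Abs_fps (\<lambda>n. of_int (c5 (int n))) = 1 / Psi (- (fps_X ^ 5)) (fps_X :: complex fps)"
proof -
  let ?P = "Psi (- (fps_X ^ 5)) (fps_X :: complex fps)"
  let ?C = "Abs_fps (\<lambda>n. of_int (c5 (int n))) :: complex fps"
  have P: "fps_nth ?P k = of_int (fps_nth (Psi (- (fps_X ^ 5)) (fps_X :: int fps)) k)" for k
    by (simp add: Psi_nth)
  have "?C * ?P = 1"
  proof (rule fps_ext)
    fix k
    have "fps_nth (?C * ?P) k =
        of_int (fps_nth (Abs_fps (\<lambda>n. c5 (int n)) * Psi (- (fps_X ^ 5)) fps_X) k)"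
      by (simp add: fps_mult_nth P)
    thus "fps_nth (?C * ?P) k = fps_nth 1 k"
      by (simp add: c5_generating_function)
  qed
  moreover have "?P \<noteq> 0" using Psi_nth_0 by (metis fps_zero_nth zero_neq_one)
  ultimately show ?thesis
    by (metis nonzero_mult_div_cancel_right)
qed

end

theory Submission
  imports Defs "HOL-Number_Theory.Gauss"
begin

text \<open>
  Write \<open>\<Psi>(-q\<^sup>5, q) = A + B\<close>, where \<open>A\<close> collects the terms with \<open>n\<close> even and \<open>B\<close> those with \<open>n\<close>
  odd; their exponents are \<open>0\<close> and \<open>1\<close> modulo 4, so the part \<open>S\<close> of \<open>1 / \<Psi>\<close> with exponents \<open>3\<close>
  modulo 4 satisfies \<open>S (B\<^sup>4 - A\<^sup>4) = B\<^sup>3\<close>. Modulo 4, the signs of the false theta function no longer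
  affect \<open>A\<^sup>4\<close> and \<open>B\<^sup>4\<close>, and the substitution \<open>(a, b) = (c + d, c - d)\<close> gives
  \<open>B\<^sup>4 - A\<^sup>4 = - U \<Phi>\<close> with theta series \<open>U = \<Sum> (-1)\<^sup>c q\<^bsup>12 c\<^sup>2 + 8 c\<^esup>\<close> and
  \<open>\<Phi> = \<Sum> (-1)\<^sup>d q\<^bsup>12 d\<^sup>2\<^esup> = 1 + 2 F\<close>, while \<open>B = q (U + 2 W)\<close>. Hence
  \<open>S = - q\<^sup>3 (U\<^sup>2 + 2 U W + 2 F U\<^sup>2)\<close> modulo 4. The coefficient of \<open>q\<^sup>N\<close> on the right only involves
  representations of \<open>(3 N - 1) / 4\<close> by \<open>x\<^sup>2 + y\<^sup>2\<close> and \<open>x\<^sup>2 + 2 y\<^sup>2\<close>, and there are none when a prime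
  \<open>p\<close> congruent to 7 modulo 8 divides this number to an odd power.
\<close>

unbundle fps_syntax

section \<open>The binary forms \<open>x\<^sup>2 + y\<^sup>2\<close> and \<open>x\<^sup>2 + 2 y\<^sup>2\<close>\<close>

text \<open>Otherwise raising \<open>x^2 = -y^2\<close> to the odd power \<open>(p - 1) / 2\<close>
  gives \<open>1 = -1\<close> modulo \<open>p\<close> by Fermat.\<close>

lemma prime_dvd_sum_two_squares:
  fixes p :: nat and x y :: int
  assumes "prime p" "p mod 4 = 3" "int p dvd x\<^sup>2 + y\<^sup>2"
  shows "int p dvd y"
proof (rule ccontr)
  assume y: "\<not> int p dvd y"
  have P: "prime (int p)" using assms by simp
  have x: "\<not> int p dvd x"
  proof
    assume "int p dvd x"
    hence "int p dvd x\<^sup>2" by (simp add: power2_eq_square)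
    hence "int p dvd y\<^sup>2" using assms(3) by (simp add: dvd_add_right_iff)
    thus False using y P prime_dvd_power by blast
  qed
  \<comment> \<open>Fermat's theorem is applied to the natural number \<open>|z|\<close>; the
    exponent \<open>p - 1\<close> is even, so the absolute value disappears.\<close>
  have flt: "[z ^ (p - 1) = 1] (mod int p)" if "\<not> int p dvd z" for z
  proof -
    have "[nat \<bar>z\<bar> ^ (p - 1) = 1] (mod p)"
      using fermat_theorem[OF assms(1), of "nat \<bar>z\<bar>"] that by simp
    hence "[\<bar>z\<bar> ^ (p - 1) = 1] (mod int p)"
      by (metis abs_ge_zero cong_int_iff int_nat_eq of_nat_1 of_nat_power)
    moreover have "even (p - 1)" using assms(2) by presburger
    ultimately show ?thesis by (simp add: power_even_abs)
  qed
  define h where "h = (p - 1) div 2"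
  have h: "p - 1 = 2 * h" "odd h" using assms(2) unfolding h_def by presburger+
  have "[x\<^sup>2 = - (y\<^sup>2)] (mod int p)"
    using assms(3) by (simp add: cong_iff_dvd_diff)
  hence "[(x\<^sup>2) ^ h = (- (y\<^sup>2)) ^ h] (mod int p)" by (rule cong_pow)
  hence "[x ^ (p - 1) = - (y ^ (p - 1))] (mod int p)"
    using h by (simp add: power_mult)
  moreover have "[- (y ^ (p - 1)) = - 1] (mod int p)"
    using flt[OF y] by (simp add: cong_minus_minus_iff)
  ultimately have "[1 = - 1] (mod int p)"
    using flt[OF x] by (metis cong_sym cong_trans)
  hence "int p dvd 2" by (simp add: cong_iff_dvd_diff)
  hence "int p \<le> 2" by (rule zdvd_imp_le) simp
  hence "p \<le> 2" by simp
  moreover have "p \<ge> 3" using assms(2) by presburger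
  ultimately show False by simp
qed

text \<open>Gauss's lemma: for \<open>p = 8 t + 7\<close> the doubled residues above
  \<open>(p - 1) / 2\<close> are the even numbers from \<open>4 t + 4\<close> to
  \<open>8 t + 6\<close>, and their number \<open>2 t + 2\<close> is even.\<close>

lemma QuadRes_two:
  fixes p :: nat
  assumes "prime p" "p mod 8 = 7"
  shows "QuadRes (int p) 2"
proof -
  define t where "t = p div 8"
  have p: "p = 8 * t + 7" using assms(2) unfolding t_def by presburger
  have nd: "\<not> int p dvd 2"
  proof
    assume "int p dvd 2"
    hence "int p \<le> 2" by (rule zdvd_imp_le) simp
    thus False using p by simp
  qed
  interpret GAUSS p 2
    by unfold_locales (use assms p nd in \<open>auto simp: cong_0_iff\<close>)
  have "E = (\<lambda>j. 4 * int t + 4 + 2 * j) ` {0..2 * int t + 1}"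
  proof -
    have half: "(int p - 1) div 2 = 4 * int t + 3" using p by simp
    \<comment> \<open>Reduction modulo \<open>p\<close> changes nothing, since the doubled residues
      stay below \<open>p\<close>.\<close>
    have "C = (\<lambda>x. x * 2) ` {0<..4 * int t + 3}"
      unfolding C_def B_def A_def half image_image
      by (rule image_cong) (auto simp: p)
    hence E: "E = (\<lambda>x. x * 2) ` {0<..4 * int t + 3} \<inter> {4 * int t + 3<..}"
      unfolding E_def half by simp
    show ?thesis
    proof (intro equalityI subsetI)
      fix z assume "z \<in> E"
      then obtain x where x: "z = x * 2" "x \<le> 4 * int t + 3" "z > 4 * int t + 3"
        unfolding E by auto
      show "z \<in> (\<lambda>j. 4 * int t + 4 + 2 * j) ` {0..2 * int t + 1}"
        by (rule image_eqI[of _ _ "x - 2 * int t - 2"]) (use x in auto)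
    next
      fix z assume "z \<in> (\<lambda>j. 4 * int t + 4 + 2 * j) ` {0..2 * int t + 1}"
      then obtain j where "z = 4 * int t + 4 + 2 * j" "0 \<le> j" "j \<le> 2 * int t + 1" by auto
      thus "z \<in> E" unfolding E
        by (auto intro!: image_eqI[of _ _ "2 * int t + 2 + j"])
    qed
  qed
  hence "card E = 2 * t + 2"
    by (simp add: card_image inj_on_def nat_add_distrib nat_mult_distrib)
  hence "Legendre 2 (int p) = 1" using gauss_lemma by simp
  thus ?thesis by (simp add: Legendre_def split: if_splits)
qed

text \<open>A square root \<open>z\<close> of 2 modulo \<open>p\<close> turns the form into
  \<open>x^2 + (z y)^2\<close>, and \<open>p\<close> does not divide \<open>z\<close>.\<close>

lemma prime_dvd_square_plus_twice_square:
  fixes p :: nat and x y :: int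
  assumes "prime p" "p mod 8 = 7" "int p dvd x\<^sup>2 + 2 * y\<^sup>2"
  shows "int p dvd y"
proof -
  have P: "prime (int p)" using assms by simp
  obtain z where z: "[z\<^sup>2 = 2] (mod int p)"
    using QuadRes_two[OF assms(1,2)] by (auto simp: QuadRes_def)
  have "[x\<^sup>2 + z\<^sup>2 * y\<^sup>2 = x\<^sup>2 + 2 * y\<^sup>2] (mod int p)"
    by (intro cong_add cong_mult z cong_refl)
  hence "int p dvd x\<^sup>2 + (z * y)\<^sup>2"
    using assms(3) by (simp add: power_mult_distrib cong_dvd_iff)
  moreover have "p mod 4 = 3" using assms(2) by presburger
  ultimately have "int p dvd z * y" using prime_dvd_sum_two_squares assms(1) by blast
  moreover have "\<not> int p dvd z"
  proof
    assume "int p dvd z"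
    hence "int p dvd z\<^sup>2" by (simp add: power2_eq_square)
    hence "int p dvd 2" using z by (simp add: cong_dvd_iff)
    hence "int p \<le> 2" by (rule zdvd_imp_le) simp
    hence "p \<le> 2" by simp
    moreover have "p \<ge> 7" using assms(2) by presburger
    ultimately show False by simp
  qed
  ultimately show ?thesis using P by (simp add: prime_dvd_mult_iff)
qed

text \<open>Descent: \<open>p\<close> divides \<open>y\<close>, hence also \<open>x\<close>, so a
  factor \<open>p^2\<close> cancels. An odd exponent finally leaves a single \<open>p\<close>, which
  would force \<open>p\<close> to divide \<open>m\<close>.\<close>

lemma odd_prime_power_not_represented:
  fixes p :: nat and c m x y :: int
  assumes "prime p" and anis: "\<And>x y. int p dvd x\<^sup>2 + c * y\<^sup>2 \<Longrightarrow> int p dvd y"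
    and "\<not> int p dvd m"
  shows "x\<^sup>2 + c * y\<^sup>2 \<noteq> int p ^ (2 * k + 1) * m"
proof (induction k arbitrary: x y)
  have P: "prime (int p)" using assms(1) by simp
  have descent: "\<exists>x' y'. n = int p * (x'\<^sup>2 + c * y'\<^sup>2)" if "x\<^sup>2 + c * y\<^sup>2 = int p * n" for x y n :: int
  proof -
    have "int p dvd y" by (rule anis[of x y]) (simp add: that)
    then obtain y' where y: "y = int p * y'" ..
    have "int p dvd x\<^sup>2 + c * y\<^sup>2" using that by simp
    hence "int p dvd x\<^sup>2" by (simp add: y power2_eq_square dvd_add_left_iff)
    hence "int p dvd x" using P prime_dvd_power by blast
    then obtain x' where x: "x = int p * x'" ..
    have "int p * n = int p * (int p * (x'\<^sup>2 + c * y'\<^sup>2))"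
      using that by (simp add: x y algebra_simps power2_eq_square)
    thus ?thesis using P by auto
  qed
  case 0
  show ?case using descent[of x y m] assms(3) by auto
  case (Suc k)
  show ?case
  proof
    assume "x\<^sup>2 + c * y\<^sup>2 = int p ^ (2 * Suc k + 1) * m"
    hence "x\<^sup>2 + c * y\<^sup>2 = int p * (int p * (int p ^ (2 * k + 1) * m))" by simp
    from descent[OF this] obtain x' y' where
      "int p * (int p ^ (2 * k + 1) * m) = int p * (x'\<^sup>2 + c * y'\<^sup>2)" by blast
    hence "x'\<^sup>2 + c * y'\<^sup>2 = int p ^ (2 * k + 1) * m" using P by auto
    thus False using Suc.IH by blast
  qed
qed

section \<open>Power series indexed by quadratic exponents\<close>

text \<open>Formally the sum of \<open>w a * q^(e a)\<close> over \<open>A\<close>. Negative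
  exponents are dropped and infinite fibres contribute 0; \<open>finite_fibers\<close> excludes
  both.\<close>

definition index_series :: "'a set \<Rightarrow> ('a \<Rightarrow> int) \<Rightarrow> ('a \<Rightarrow> int) \<Rightarrow> int fps" where
  "index_series A e w = Abs_fps (\<lambda>n. \<Sum>a | a \<in> A \<and> e a = int n. w a)"

definition finite_fibers :: "'a set \<Rightarrow> ('a \<Rightarrow> int) \<Rightarrow> bool" where
  "finite_fibers A e \<longleftrightarrow> (\<forall>a\<in>A. e a \<ge> 0) \<and> (\<forall>n. finite {a \<in> A. e a = n})"

lemma finite_fibersI_abs:
  fixes e :: "int \<Rightarrow> int"
  assumes "\<And>c. c \<in> A \<Longrightarrow> \<bar>c\<bar> \<le> e c"
  shows "finite_fibers A e"
  unfolding finite_fibers_def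
proof (intro conjI ballI allI)
  fix n show "finite {a \<in> A. e a = n}"
    by (rule finite_subset[of _ "{-\<bar>n\<bar>..\<bar>n\<bar>}"]) (use assms in force, simp)
qed (use assms abs_ge_zero order_trans in blast)

lemma finite_fibers_Times:
  assumes "finite_fibers A e" "finite_fibers B f"
  shows "finite_fibers (A \<times> B) (\<lambda>(a, b). e a + f b)"
  unfolding finite_fibers_def
proof (intro conjI ballI allI)
  fix n
  have sub: "{x \<in> A \<times> B. (case x of (a, b) \<Rightarrow> e a + f b) = n} \<subseteq>
      (\<Union>i\<in>{0..n}. {a \<in> A. e a = i} \<times> {b \<in> B. f b = n - i})"
    using assms by (force simp: finite_fibers_def)
  show "finite {x \<in> A \<times> B. (case x of (a, b) \<Rightarrow> e a + f b) = n}"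
    by (rule finite_subset[OF sub]) (use assms in \<open>auto simp: finite_fibers_def\<close>)
qed (use assms in \<open>auto simp: finite_fibers_def\<close>)

lemma finite_fibers_subset: "finite_fibers B e \<Longrightarrow> A \<subseteq> B \<Longrightarrow> finite_fibers A e"
  unfolding finite_fibers_def by (blast intro: finite_subset[rotated])

lemma index_series_nth_eq_0:
  "(\<And>a. a \<in> A \<Longrightarrow> e a \<noteq> int n) \<Longrightarrow> index_series A e w $ n = 0"
  by (auto simp: index_series_def intro!: sum.neutral)

text \<open>The Cauchy product: the fibre of the summed exponent over \<open>n\<close> is the
  disjoint union of the products of the fibres over \<open>i\<close> and
  \<open>n - i\<close>.\<close>

lemma index_series_mult:
  assumes "finite_fibers A e" "finite_fibers B f"
  shows "index_series A e w * index_series B f v =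
    index_series (A \<times> B) (\<lambda>(a, b). e a + f b) (\<lambda>(a, b). w a * v b)"
proof (rule fps_ext)
  fix n
  let ?F = "\<lambda>i. {a \<in> A. e a = int i} \<times> {b \<in> B. f b = int (n - i)}"
  have U: "{x \<in> A \<times> B. (case x of (a, b) \<Rightarrow> e a + f b) = int n} = (\<Union>i\<in>{0..n}. ?F i)"
  proof (intro equalityI subsetI)
    fix x assume "x \<in> {x \<in> A \<times> B. (case x of (a, b) \<Rightarrow> e a + f b) = int n}"
    then obtain a b where x: "x = (a, b)" "a \<in> A" "b \<in> B" "e a + f b = int n" by auto
    have "e a \<ge> 0" "f b \<ge> 0" using assms x by (auto simp: finite_fibers_def)
    hence "x \<in> ?F (nat (e a))" "nat (e a) \<in> {0..n}" using x by auto
    thus "x \<in> (\<Union>i\<in>{0..n}. ?F i)" by blast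
  qed (auto simp: of_nat_diff)
  have "(\<Sum>(a, b) \<in> (\<Union>i\<in>{0..n}. ?F i). w a * v b) = (\<Sum>i=0..n. \<Sum>(a, b) \<in> ?F i. w a * v b)"
    by (rule sum.UNION_disjoint) (use assms in \<open>auto simp: finite_fibers_def\<close>)
  also have "\<dots> = (\<Sum>i=0..n. (\<Sum>a | a \<in> A \<and> e a = int i. w a) * (\<Sum>b | b \<in> B \<and> f b = int (n - i). v b))"
    by (simp add: sum_product sum.cartesian_product)
  finally show "(index_series A e w * index_series B f v) $ n =
      index_series (A \<times> B) (\<lambda>(a, b). e a + f b) (\<lambda>(a, b). w a * v b) $ n"
    by (simp add: index_series_def fps_mult_nth U [simplified])
qed

lemma index_series_reindex:
  assumes "bij_betw h A B" "\<And>a. a \<in> A \<Longrightarrow> e' a = e (h a)" "\<And>a. a \<in> A \<Longrightarrow> w' a = w (h a)"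
  shows "index_series B e w = index_series A e' w'"
proof (rule fps_ext)
  fix n
  have "bij_betw h {a \<in> A. e' a = int n} {b \<in> B. e b = int n}"
    using assms(1,2) by (auto simp: bij_betw_def inj_on_def)
  hence "(\<Sum>a | a \<in> A \<and> e' a = int n. w (h a)) = (\<Sum>b | b \<in> B \<and> e b = int n. w b)"
    by (rule sum.reindex_bij_betw)
  thus "index_series B e w $ n = index_series A e' w' $ n"
    using assms(3) by (simp add: index_series_def)
qed

lemma index_series_Un:
  assumes "finite_fibers (A \<union> B) e" "A \<inter> B = {}"
  shows "index_series (A \<union> B) e w = index_series A e w + index_series B e w"
proof (rule fps_ext)
  fix n
  have "{a \<in> A \<union> B. e a = int n} = {a \<in> A. e a = int n} \<union> {a \<in> B. e a = int n}" by auto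
  moreover have "finite {a \<in> A \<union> B. e a = int n}" using assms by (auto simp: finite_fibers_def)
  ultimately show "index_series (A \<union> B) e w $ n = (index_series A e w + index_series B e w) $ n"
    using assms(2) by (simp add: index_series_def, subst sum.union_disjoint[symmetric]) auto
qed

lemma index_series_cong:
  "(\<And>a. a \<in> A \<Longrightarrow> e a = e' a) \<Longrightarrow> (\<And>a. a \<in> A \<Longrightarrow> w a = w' a) \<Longrightarrow>
    index_series A e w = index_series A e' w'"
  by (rule index_series_reindex[of id]) auto

lemma index_series_add:
  "index_series A e w + index_series A e v = index_series A e (\<lambda>a. w a + v a)"
  by (rule fps_ext) (simp add: index_series_def sum.distrib)

lemma index_series_minus: "- index_series A e w = index_series A e (\<lambda>a. - w a)"
  by (rule fps_ext) (simp add: index_series_def sum_negf)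

lemma index_series_double: "2 * index_series A e w = index_series A e (\<lambda>a. 2 * w a)"
  unfolding mult_2 index_series_add ..

text \<open>The off-diagonal pairs come in swapped couples, and on the diagonal the signs square to
  1. Modulo 2 the square thus forgets the signs.\<close>

lemma index_series_square:
  fixes A :: "'a::linorder set"
  assumes "finite_fibers A e" "\<And>a. a \<in> A \<Longrightarrow> w a * w a = 1"
  shows "(index_series A e w)\<^sup>2 = index_series A (\<lambda>a. 2 * e a) (\<lambda>_. 1) +
    2 * index_series {(a, b). a \<in> A \<and> b \<in> A \<and> a < b} (\<lambda>(a, b). e a + e b) (\<lambda>(a, b). w a * w b)"
proof -
  let ?e = "\<lambda>(a, b). e a + e b" and ?w = "\<lambda>(a, b). w a * w b"
  let ?L = "{(a, b). a \<in> A \<and> b \<in> A \<and> a < b}" and ?G = "{(a, b). a \<in> A \<and> b \<in> A \<and> b < a}"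
  let ?D = "{(a, b). a \<in> A \<and> a = b}"
  have AA: "A \<times> A = ?D \<union> (?L \<union> ?G)" by auto
  have fin: "finite_fibers (?D \<union> (?L \<union> ?G)) ?e"
    unfolding AA [symmetric] using finite_fibers_Times[OF assms(1) assms(1)] .
  have "(index_series A e w)\<^sup>2 = index_series (?D \<union> (?L \<union> ?G)) ?e ?w"
    unfolding power2_eq_square index_series_mult[OF assms(1) assms(1)] AA ..
  also have "\<dots> = index_series ?D ?e ?w + (index_series ?L ?e ?w + index_series ?G ?e ?w)"
    by (subst index_series_Un[OF fin], force, subst index_series_Un,
        rule finite_fibers_subset[OF fin]) auto
  also have "index_series ?G ?e ?w = index_series ?L ?e ?w"
    by (rule index_series_reindex[of prod.swap]) (auto simp: bij_betw_def inj_on_def image_def)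
  also have "index_series ?D ?e ?w = index_series A (\<lambda>a. 2 * e a) (\<lambda>_. 1)"
    by (rule index_series_reindex[of "\<lambda>a. (a, a)"])
       (use assms(2) in \<open>auto simp: bij_betw_def inj_on_def\<close>)
  finally show ?thesis by (simp only: mult_2)
qed

section \<open>Coefficients in a residue class modulo 4\<close>

definition exponents_mod4 :: "nat \<Rightarrow> 'a::comm_ring_1 fps \<Rightarrow> bool" where
  "exponents_mod4 r F \<longleftrightarrow> (\<forall>n. F $ n \<noteq> 0 \<longrightarrow> n mod 4 = r)"

lemma exponents_mod4_mult:
  assumes "exponents_mod4 r F" "exponents_mod4 s G"
  shows "exponents_mod4 ((r + s) mod 4) (F * G)"
  unfolding exponents_mod4_def
proof (intro allI impI)
  fix n assume "(F * G) $ n \<noteq> 0"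
  then obtain i where i: "i \<le> n" "F $ i * G $ (n - i) \<noteq> 0"
    by (auto simp: fps_mult_nth elim: sum.not_neutral_contains_not_neutral)
  hence "F $ i \<noteq> 0" "G $ (n - i) \<noteq> 0" by auto
  hence "i mod 4 = r" "(n - i) mod 4 = s" using assms by (auto simp: exponents_mod4_def)
  hence "(i + (n - i)) mod 4 = (r + s) mod 4" by (metis mod_add_eq)
  thus "n mod 4 = (r + s) mod 4" using i by simp
qed

lemma exponents_mod4_index_series:
  assumes "\<And>a. a \<in> A \<Longrightarrow> e a mod 4 = int r"
  shows "exponents_mod4 r (index_series A e w)"
  unfolding exponents_mod4_def
proof (intro allI impI)
  fix n assume "index_series A e w $ n \<noteq> 0"
  then obtain a where "a \<in> A" "e a = int n" using index_series_nth_eq_0[of A e n w] by auto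
  hence "int n mod 4 = int r" using assms by metis
  hence "int (n mod 4) = int r" by (simp add: zmod_int)
  thus "n mod 4 = r" by simp
qed

lemma exponents_mod4D: "exponents_mod4 r F \<Longrightarrow> n mod 4 \<noteq> r \<Longrightarrow> F $ n = 0"
  by (auto simp: exponents_mod4_def)

lemma exponents_mod4_diff:
  "exponents_mod4 r F \<Longrightarrow> exponents_mod4 r G \<Longrightarrow> exponents_mod4 r (F - G)"
  unfolding exponents_mod4_def fps_sub_nth by (metis diff_zero)

definition part3 :: "'a::comm_ring_1 fps \<Rightarrow> 'a fps" where
  "part3 F = Abs_fps (\<lambda>n. if n mod 4 = 3 then F $ n else 0)"

text \<open>Multiplication by \<open>K\<close> only shifts exponents by multiples of 4.\<close>

lemma part3_mult:
  assumes "exponents_mod4 0 K"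
  shows "part3 (F * K) = part3 F * K"
proof (rule fps_ext)
  fix n
  have "(if n mod 4 = 3 then F $ i * K $ (n - i) else 0) = part3 F $ i * K $ (n - i)"
    if "i \<le> n" for i
  proof (cases "K $ (n - i) = 0")
    case False
    hence "(n - i) mod 4 = 0" using assms by (auto simp: exponents_mod4_def)
    hence "(i + (n - i)) mod 4 = i mod 4" by (metis add.right_neutral mod_add_right_eq)
    thus ?thesis using that by (simp add: part3_def)
  qed simp
  hence "(\<Sum>i=0..n. if n mod 4 = 3 then F $ i * K $ (n - i) else 0) =
      (\<Sum>i=0..n. part3 F $ i * K $ (n - i))"
    by (intro sum.cong) auto
  thus "part3 (F * K) $ n = (part3 F * K) $ n"
    by (cases "n mod 4 = 3") (simp_all add: part3_def fps_mult_nth)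
qed

text \<open>For a primitive fourth root of unity \<open>i\<close>, substituting \<open>i q\<close> for \<open>q\<close> sends \<open>A + B\<close> to \<open>A + i B\<close>, and
  \<open>A\<^sup>4 - B\<^sup>4\<close> is the product of the four conjugates.\<close>
lemma part3_reciprocal:
  fixes A B C :: "'a::comm_ring_1 fps"
  assumes A: "exponents_mod4 0 A" and B: "exponents_mod4 1 B" and "C * (A + B) = 1"
  shows "part3 C * (B^4 - A^4) = B^3"
proof -
  note m = exponents_mod4_mult
  have AA: "exponents_mod4 0 (A * A)" and BB: "exponents_mod4 2 (B * B)"
    using m[OF A A] m[OF B B] by (simp_all add: numeral_2_eq_2)
  have A3: "exponents_mod4 0 (A * A * A)" and BA: "exponents_mod4 1 (A * A * B)"
    and AB: "exponents_mod4 2 (B * B * A)" and B3: "exponents_mod4 3 (B * B * B)"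
    and A4: "exponents_mod4 0 (A * A * (A * A))" and B4: "exponents_mod4 0 (B * B * (B * B))"
    using m[OF AA A] m[OF AA B] m[OF BB A] m[OF BB B] m[OF AA AA] m[OF BB BB] by simp_all
  have K: "exponents_mod4 0 (B^4 - A^4)"
    using exponents_mod4_diff[OF B4 A4] by (simp add: power4_eq_xxxx mult.assoc)
  \<comment> \<open>The factor \<open>A + B\<close> of \<open>B^4 - A^4\<close> cancels against
    \<open>C\<close>. The four terms of the cofactor have exponents 3, 2, 1, 0 modulo 4, so only
    \<open>B^3\<close> survives in \<open>part3\<close>.\<close>
  have "C * (B^4 - A^4) = C * (A + B) * (B * B * B - B * B * A + A * A * B - A * A * A)"
    by (simp add: algebra_simps power4_eq_xxxx)
  hence "part3 C * (B^4 - A^4) = part3 (B * B * B - B * B * A + A * A * B - A * A * A)"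
    by (simp add: part3_mult[OF K, symmetric] assms(3))
  also have "\<dots> = B * B * B"
  proof (rule fps_ext)
    fix n
    show "part3 (B * B * B - B * B * A + A * A * B - A * A * A) $ n = (B * B * B) $ n"
      by (cases "n mod 4 = 3")
         (simp_all add: part3_def exponents_mod4D[OF A3] exponents_mod4D[OF BA]
           exponents_mod4D[OF AB] exponents_mod4D[OF B3])
  qed
  finally show ?thesis by (simp add: power3_eq_cube)
qed

section \<open>The false theta function modulo 4\<close>

text \<open>These bounds feed \<open>finite_fibersI_abs\<close>; they follow from
  \<open>|c| \<le> c^2\<close> for integers.\<close>

lemma abs_le_exponents:
  fixes c :: int
  shows "\<bar>c\<bar> \<le> 3 * c\<^sup>2 + 2 * c" "\<bar>c\<bar> \<le> 12 * c\<^sup>2 + 8 * c" "\<bar>c\<bar> \<le> 12 * c\<^sup>2"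
proof -
  have "\<bar>c\<bar> * 1 \<le> \<bar>c\<bar> * \<bar>c\<bar>" by (cases "c = 0") (simp, rule mult_left_mono, auto)
  hence "\<bar>c\<bar> \<le> c\<^sup>2" by (simp add: power2_eq_square)
  thus "\<bar>c\<bar> \<le> 3 * c\<^sup>2 + 2 * c" "\<bar>c\<bar> \<le> 12 * c\<^sup>2 + 8 * c" "\<bar>c\<bar> \<le> 12 * c\<^sup>2" by auto
qed

text \<open>Absorbs the minus sign before the second sum of \<open>Psi\<close>, leaving one sum over
  all integers.\<close>

definition false_sign :: "int \<Rightarrow> int" where
  "false_sign n = (if n \<ge> 0 then 1 else - 1) * (- 1) ^ nat (n * (n + 1) div 2)"

text \<open>This is \<open>(-1)^n\<close>, extended to negative \<open>n\<close>.\<close>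

definition parity_sign :: "int \<Rightarrow> int" where
  "parity_sign n = (if even n then 1 else - 1)"

lemma false_sign_square: "false_sign n * false_sign n = 1"
  unfolding false_sign_def by (auto simp: mult_ac simp flip: power_add mult_2)

lemma parity_sign_square: "parity_sign n * parity_sign n = 1"
  by (simp add: parity_sign_def)

lemma odd_false_sign: "odd (false_sign n)"
  by (simp add: false_sign_def)

lemma Psi_eq_index_series:
  "Psi (- (fps_X ^ 5)) (fps_X :: int fps) = index_series UNIV (\<lambda>n. 3 * n\<^sup>2 + 2 * n) false_sign"
proof (rule fps_ext)
  fix k
  have U: "{a \<in> UNIV. 3 * a\<^sup>2 + 2 * a = int k} =
      {n. n \<ge> 0 \<and> int k = 3 * n\<^sup>2 + 2 * n} \<union> {n. n \<le> -1 \<and> int k = 3 * n\<^sup>2 + 2 * n}"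
    by auto
  have fin: "finite {n. n \<ge> 0 \<and> int k = 3 * n\<^sup>2 + 2 * n}" "finite {n. n \<le> -1 \<and> int k = 3 * n\<^sup>2 + 2 * n}"
    by (rule finite_subset[OF _ Psi_exponent_finite[of k]], auto)+
  show "Psi (- (fps_X ^ 5)) (fps_X :: int fps) $ k =
      index_series UNIV (\<lambda>n. 3 * n\<^sup>2 + 2 * n) false_sign $ k"
    unfolding index_series_def fps_nth_Abs_fps U Psi_nth
    by (subst sum.union_disjoint[OF fin])
       (auto simp: false_sign_def sum_negf[symmetric] intro!: arg_cong2[of _ _ _ _ "(+)"] sum.cong)
qed

lemma X_times_index_series:
  assumes "finite_fibers A e"
  shows "fps_X * index_series A e w = index_series A (\<lambda>a. e a + 1) w"
proof (rule fps_ext)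
  fix n
  have "e a + 1 = int n \<longleftrightarrow> n \<noteq> 0 \<and> e a = int (n - 1)" if "a \<in> A" for a
    using assms that by (cases n) (force simp: finite_fibers_def)+
  hence "{a \<in> A. e a + 1 = int n} = (if n = 0 then {} else {a \<in> A. e a = int (n - 1)})"
    by auto
  thus "(fps_X * index_series A e w) $ n = index_series A (\<lambda>a. e a + 1) w $ n"
    by (simp add: index_series_def)
qed

section \<open>Splitting by the parity of the index\<close>

definition "even_series = index_series {n. even n} (\<lambda>n. 3 * n\<^sup>2 + 2 * n) false_sign"
text \<open>An odd index \<open>n = -1 - 2 c\<close> has exponent \<open>12 c^2 + 8 c + 1\<close>;
  splitting off one factor \<open>fps_X\<close> leaves the exponents of
  \<open>U_series\<close>.\<close>

definition "odd_series = index_series UNIV (\<lambda>c. 12 * c\<^sup>2 + 8 * c) (\<lambda>c. false_sign (- 1 - 2 * c))"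
definition "U_series = index_series UNIV (\<lambda>c. 12 * c\<^sup>2 + 8 * c) parity_sign"
definition "Phi_series = index_series UNIV (\<lambda>d. 12 * d\<^sup>2) parity_sign"

lemma X_times_odd_series:
  "fps_X * odd_series = index_series {n. odd n} (\<lambda>n. 3 * n\<^sup>2 + 2 * n) false_sign"
proof -
  have "index_series {n. odd n} (\<lambda>n. 3 * n\<^sup>2 + 2 * n) false_sign =
      index_series UNIV (\<lambda>c. 12 * c\<^sup>2 + 8 * c + 1) (\<lambda>c. false_sign (- 1 - 2 * c))"
  proof (rule index_series_reindex)
    show "bij_betw (\<lambda>c. - 1 - 2 * c :: int) UNIV {n. odd n}"
      by (rule bij_betw_byWitness[where f' = "\<lambda>n. (- 1 - n) div 2"]) auto
  qed (auto simp: algebra_simps power2_eq_square)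
  also have "\<dots> = fps_X * odd_series"
    unfolding odd_series_def
    by (rule X_times_index_series[symmetric]) (use abs_le_exponents in \<open>auto intro!: finite_fibersI_abs\<close>)
  finally show ?thesis ..
qed

lemma Psi_eq_even_odd: "Psi (- (fps_X ^ 5)) fps_X = even_series + fps_X * odd_series"
proof -
  have U: "(UNIV :: int set) = {n. even n} \<union> {n. odd n}" by auto
  show ?thesis
    unfolding Psi_eq_index_series even_series_def X_times_odd_series
    by (subst U, rule index_series_Un)
       (use abs_le_exponents in \<open>auto intro!: finite_fibersI_abs\<close>)
qed

text \<open>Pairs of equal parity are exactly the pairs \<open>(c + d, c - d)\<close>. In these
  coordinates the exponent separates into \<open>12 c^2 + 8 c\<close> and \<open>12 d^2\<close>, and
  the sign of \<open>c + d\<close> is the product of the signs of \<open>c\<close> and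
  \<open>d\<close>.\<close>

lemma theta_dissection:
  defines "f \<equiv> \<lambda>n::int. 2 * (3 * n\<^sup>2 + 2 * n)"
  shows "(index_series {n. odd n} f (\<lambda>_. 1))\<^sup>2 - (index_series {n. even n} f (\<lambda>_. 1))\<^sup>2
    = - (U_series * Phi_series)"
proof -
  let ?e = "\<lambda>(a, b). f a + f b" and ?w = "\<lambda>(a, b). parity_sign a :: int"
  let ?O = "{n::int. odd n}" and ?E = "{n::int. even n}"
  have ff: "finite_fibers A f" for A
    unfolding f_def by (rule finite_fibersI_abs) (use abs_le_exponents(1) in \<open>smt (verit)\<close>)
  have "index_series (?O \<times> ?O \<union> ?E \<times> ?E) ?e ?w =
      index_series (?O \<times> ?O) ?e ?w + index_series (?E \<times> ?E) ?e ?w"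
    by (rule index_series_Un, rule finite_fibers_subset[OF finite_fibers_Times[OF ff ff]]) auto
  also have "index_series (?E \<times> ?E) ?e ?w = (index_series ?E f (\<lambda>_. 1))\<^sup>2"
    unfolding power2_eq_square index_series_mult[OF ff ff]
    by (rule index_series_cong) (auto simp: parity_sign_def)
  also have "index_series (?O \<times> ?O) ?e ?w = - (index_series ?O f (\<lambda>_. 1))\<^sup>2"
    unfolding power2_eq_square index_series_mult[OF ff ff] index_series_minus
    by (rule index_series_cong) (auto simp: parity_sign_def)
  also have "index_series (?O \<times> ?O \<union> ?E \<times> ?E) ?e ?w =
      index_series (UNIV \<times> UNIV) (\<lambda>(c, d). (12 * c\<^sup>2 + 8 * c) + 12 * d\<^sup>2)
        (\<lambda>(c, d). parity_sign c * parity_sign d)"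
  proof (rule index_series_reindex)
    show "bij_betw (\<lambda>(c, d). (c + d, c - d)) (UNIV \<times> UNIV) (?O \<times> ?O \<union> ?E \<times> ?E)"
      by (rule bij_betw_byWitness[where f' = "\<lambda>(a, b). ((a + b) div 2, (a - b) div 2)"])
         (auto elim!: evenE oddE simp: algebra_simps, presburger+)
  qed (auto simp: f_def parity_sign_def algebra_simps power2_eq_square)
  also have "\<dots> = U_series * Phi_series"
    unfolding U_series_def Phi_series_def
    by (rule index_series_mult[symmetric]; rule finite_fibersI_abs; rule abs_le_exponents)
  finally show ?thesis by simp
qed

text \<open>Squaring lifts a congruence modulo 2 to one modulo 4. With \<open>G\<close> the diagonal
  part of a squared series, this removes the signs.\<close>

lemma four_dvd_power4_minus_square:
  fixes F :: "'a::comm_ring_1"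
  assumes "F\<^sup>2 = G + 2 * H"
  shows "4 dvd F ^ 4 - G\<^sup>2"
proof -
  have "F ^ 4 = (F\<^sup>2)\<^sup>2" by (simp flip: power_mult)
  also have "\<dots> = G\<^sup>2 + 4 * (G * H + H\<^sup>2)"
    unfolding assms by (simp add: algebra_simps power2_eq_square)
  finally have "F ^ 4 - G\<^sup>2 = 4 * (G * H + H\<^sup>2)" by simp
  thus ?thesis by simp
qed

lemma four_dvd_fourth_powers:
  "4 dvd (fps_X * odd_series) ^ 4 - even_series ^ 4 + U_series * Phi_series"
proof -
  let ?e = "\<lambda>n::int. 3 * n\<^sup>2 + 2 * n"
  have ff: "finite_fibers A ?e" for A
    by (rule finite_fibersI_abs) (rule abs_le_exponents)
  note sq = index_series_square[OF ff false_sign_square]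
  have 1: "4 dvd (fps_X * odd_series) ^ 4 - (index_series {n. odd n} (\<lambda>n. 2 * ?e n) (\<lambda>_. 1))\<^sup>2"
    unfolding X_times_odd_series by (rule four_dvd_power4_minus_square, rule sq)
  have 2: "4 dvd even_series ^ 4 - (index_series {n. even n} (\<lambda>n. 2 * ?e n) (\<lambda>_. 1))\<^sup>2"
    unfolding even_series_def by (rule four_dvd_power4_minus_square, rule sq)
  have UP: "U_series * Phi_series = (index_series {n. even n} (\<lambda>n. 2 * ?e n) (\<lambda>_. 1))\<^sup>2 -
      (index_series {n. odd n} (\<lambda>n. 2 * ?e n) (\<lambda>_. 1))\<^sup>2"
    by (subst minus_diff_eq[symmetric], unfold theta_dissection) simp
  show ?thesis using dvd_diff[OF 1 2] unfolding UP by (simp add: algebra_simps)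
qed

text \<open>The two series have the same exponents and odd weights, so \<open>w\<close> is half the
  difference of the weights.\<close>

lemma odd_series_eq:
  "\<exists>w. odd_series = U_series + 2 * index_series UNIV (\<lambda>c. 12 * c\<^sup>2 + 8 * c) w"
proof
  show "odd_series = U_series + 2 * index_series UNIV (\<lambda>c. 12 * c\<^sup>2 + 8 * c)
      (\<lambda>c. (false_sign (- 1 - 2 * c) - parity_sign c) div 2)"
    unfolding odd_series_def U_series_def index_series_double index_series_add
    by (rule index_series_cong) (auto simp: odd_false_sign parity_sign_def)
qed

text \<open>The indices \<open>d\<close> and \<open>-d\<close> contribute equally.\<close>

lemma Phi_series_eq:
  "Phi_series = 1 + 2 * index_series {0<..} (\<lambda>d. 12 * d\<^sup>2) parity_sign"
proof -
  let ?e = "\<lambda>d::int. 12 * d\<^sup>2"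
  have ff: "finite_fibers A ?e" for A
    by (rule finite_fibersI_abs) (rule abs_le_exponents)
  have U: "(UNIV :: int set) = {0} \<union> ({0<..} \<union> {..<0})" by auto
  have "Phi_series = index_series {0} ?e parity_sign +
      (index_series {0<..} ?e parity_sign + index_series {..<0} ?e parity_sign)"
    unfolding Phi_series_def U by (subst index_series_Un[OF ff], force, subst index_series_Un[OF ff]) auto
  also have "index_series {..<0} ?e parity_sign = index_series {0<..} ?e parity_sign"
    by (rule index_series_reindex[of uminus])
       (auto simp: parity_sign_def intro!: bij_betw_byWitness[where f' = uminus])
  also have "index_series {0} ?e parity_sign = 1"
  proof (rule fps_ext)
    fix n
    have "{a \<in> {0}. 12 * a\<^sup>2 = int n} = (if n = 0 then {0} else {})" by auto
    thus "index_series {0} ?e parity_sign $ n = 1 $ n"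
      by (simp add: index_series_def parity_sign_def)
  qed
  finally show ?thesis by (simp only: mult_2)
qed

text \<open>Only \<open>c = 0\<close> has exponent 0, so the constant term is 1.\<close>

lemma U_series_invertible: "\<exists>V. U_series * V = 1"
proof -
  have "{c \<in> UNIV. 12 * c\<^sup>2 + 8 * c = int 0} = {0}"
  proof (intro equalityI subsetI)
    fix c :: int assume "c \<in> {c \<in> UNIV. 12 * c\<^sup>2 + 8 * c = int 0}"
    thus "c \<in> {0}" using abs_le_exponents(2)[of c] by simp
  qed simp
  hence "U_series $ 0 = 1"
    by (simp add: U_series_def index_series_def parity_sign_def)
  hence "U_series * fps_right_inverse U_series 1 = 1"
    by (intro fps_right_inverse) simp
  thus ?thesis ..
qed

text \<open>Since \<open>(1 + 2 F)\<^sup>2 = 1\<close> modulo 4, the division by \<open>1 + 2 F\<close> becomes a multiplication.\<close>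
lemma reciprocal_mod4:
  fixes S B U F W K V X :: "'a::comm_ring_1"
  assumes SK: "S * K = (X * B) ^ 3" and K: "4 dvd K + U * (1 + 2 * F)"
    and B: "B = U + 2 * W" and V: "U * V = 1"
  shows "4 dvd S + X ^ 3 * (U\<^sup>2 + 2 * (U * W) + 2 * (F * U\<^sup>2))"
proof -
  obtain R where "K + U * (1 + 2 * F) = 4 * R" using K by (rule dvdE)
  hence R: "K = 4 * R - U * (1 + 2 * F)" by (simp add: eq_diff_eq)
  have "S * (1 + 2 * F) * U = 4 * (S * R) - (X * B) ^ 3"
    unfolding SK[symmetric] R by (simp add: algebra_simps)
  \<comment> \<open>Here \<open>V\<close> cancels \<open>U\<close>, and
    \<open>(1 + 2 F)^2 = 1 + 4 (F + F^2)\<close>.\<close>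
  hence "S * (1 + 2 * F) * U * (V * (1 + 2 * F)) = (4 * (S * R) - (X * B) ^ 3) * (V * (1 + 2 * F))"
    by simp
  also have "S * (1 + 2 * F) * U * (V * (1 + 2 * F)) = S * (1 + 2 * F) * (1 + 2 * F) * (U * V)"
    by (simp only: mult_ac)
  finally have S: "S + 4 * (S * (F + F\<^sup>2)) = (4 * (S * R) - (X * B) ^ 3) * (V * (1 + 2 * F))"
    by (simp add: V algebra_simps power2_eq_square)
  \<comment> \<open>Modulo 4, \<open>B^2\<close> equals \<open>U^2\<close>, so \<open>V\<close>
    cancels one \<open>U\<close> and leaves \<open>B U\<close>.\<close>
  have "B ^ 3 = B * U * U + 4 * (B * (U * W + W\<^sup>2))"
    by (simp add: B algebra_simps power2_eq_square power3_eq_cube)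
  hence "B ^ 3 * V = B * U * (U * V) + 4 * (B * (U * W + W\<^sup>2) * V)"
    by (simp add: algebra_simps)
  also have "B * U * (U * V) = U\<^sup>2 + 2 * (U * W)"
    by (simp add: V) (simp add: B algebra_simps power2_eq_square)
  finally have BV: "B ^ 3 * V = U\<^sup>2 + 2 * (U * W) + 4 * (B * (U * W + W\<^sup>2) * V)" .
  have "(X * B) ^ 3 * (V * (1 + 2 * F)) = X ^ 3 * (1 + 2 * F) * (B ^ 3 * V)"
    by (simp add: power_mult_distrib mult_ac)
  also have "\<dots> = X ^ 3 * (U\<^sup>2 + 2 * (U * W) + 2 * (F * U\<^sup>2)) +
      4 * (X ^ 3 * (F * U * W + (1 + 2 * F) * (B * (U * W + W\<^sup>2) * V)))"
    unfolding BV by (simp add: algebra_simps)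
  finally have XB: "(X * B) ^ 3 * (V * (1 + 2 * F)) = \<dots>" .
  have "S + X ^ 3 * (U\<^sup>2 + 2 * (U * W) + 2 * (F * U\<^sup>2)) =
    4 * (S * R * (V * (1 + 2 * F)) - S * (F + F\<^sup>2) -
      X ^ 3 * (F * U * W + (1 + 2 * F) * (B * (U * W + W\<^sup>2) * V)))"
    using S XB by (simp add: left_diff_distrib algebra_simps)
  thus ?thesis by simp
qed

section \<open>Vanishing coefficients and the congruence\<close>

lemma c5_dvd_4:
  fixes n :: nat
  assumes n: "n mod 4 = 3"
    and no1: "\<And>x y :: int. 3 * int n - 1 \<noteq> 4 * (x\<^sup>2 + y\<^sup>2)"
    and no2: "\<And>x y :: int. 3 * int n - 1 \<noteq> 4 * (x\<^sup>2 + 2 * y\<^sup>2)"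
  shows "4 dvd c5 (int n)"
proof -
  let ?e = "\<lambda>c::int. 12 * c\<^sup>2 + 8 * c" and ?d = "\<lambda>d::int. 12 * d\<^sup>2"
  have fe: "finite_fibers A ?e" and fe2: "finite_fibers A (\<lambda>c. 2 * ?e c)" and fd: "finite_fibers A ?d" for A
    by (rule finite_fibersI_abs, use abs_le_exponents in \<open>smt (verit)\<close>)+
  let ?C = "Abs_fps (\<lambda>n. c5 (int n))"
  define F where "F = index_series {0<..} ?d parity_sign"
  define U2 where "U2 = index_series UNIV (\<lambda>c. 2 * ?e c) (\<lambda>_. 1)"
  obtain w where w: "odd_series = U_series + 2 * index_series UNIV ?e w"
    using odd_series_eq by blast
  define W where "W = index_series UNIV ?e w"
  obtain V where V: "U_series * V = 1" using U_series_invertible by blast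
  obtain U' where U': "U_series\<^sup>2 = U2 + 2 * U'"
    using index_series_square[where w = parity_sign, OF fe parity_sign_square] unfolding U_series_def U2_def by blast
  have even_mod: "exponents_mod4 0 even_series"
    unfolding even_series_def
    by (rule exponents_mod4_index_series) (auto elim!: evenE simp: power2_eq_square)
  have "exponents_mod4 1 (index_series UNIV (\<lambda>c. ?e c + 1) (\<lambda>c. false_sign (- 1 - 2 * c)))"
    by (rule exponents_mod4_index_series) presburger
  hence odd_mod: "exponents_mod4 1 (fps_X * odd_series)"
    unfolding odd_series_def X_times_index_series[OF fe] .
  have K: "part3 ?C * ((fps_X * odd_series) ^ 4 - even_series ^ 4) = (fps_X * odd_series) ^ 3"
    by (rule part3_reciprocal[OF even_mod odd_mod])
       (use c5_generating_function Psi_eq_even_odd in simp)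
  have "4 dvd part3 ?C + fps_X ^ 3 * (U_series\<^sup>2 + 2 * (U_series * W) + 2 * (F * U_series\<^sup>2))"
    by (rule reciprocal_mod4[OF K _ w[folded W_def] V])
       (use four_dvd_fourth_powers Phi_series_eq in \<open>simp add: F_def\<close>)
  then obtain R where
    "part3 ?C + fps_X ^ 3 * (U_series\<^sup>2 + 2 * (U_series * W) + 2 * (F * U_series\<^sup>2)) = 4 * R"
    by (rule dvdE)
  \<comment> \<open>Under the factor 2, \<open>U_series\<close> squared matters only modulo 2.
    Replacing it by \<open>U2\<close> leaves two indices instead of three, hence a binary
    form.\<close>
  moreover have "F * U_series\<^sup>2 = F * U2 + 2 * (F * U')"
    by (simp add: U' algebra_simps)
  ultimately have "part3 ?C + fps_X ^ 3 * (U_series\<^sup>2 + 2 * (U_series * W) + 2 * (F * U2)) =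
      4 * (R - fps_X ^ 3 * (F * U'))"
    by (simp add: algebra_simps)
  hence "(part3 ?C + fps_X ^ 3 * (U_series\<^sup>2 + 2 * (U_series * W) + 2 * (F * U2))) $ n =
      (4 * (R - fps_X ^ 3 * (F * U'))) $ n"
    by (rule arg_cong)
  moreover have "n \<ge> 3" using n by presburger
  ultimately have eq: "c5 (int n) + ((U_series\<^sup>2) $ (n - 3) + 2 * ((U_series * W) $ (n - 3)) +
      2 * ((F * U2) $ (n - 3))) = 4 * ((R - fps_X ^ 3 * (F * U')) $ n)"
    using n by (simp add: part3_def numeral_fps_const fps_X_power_mult_nth)
  \<comment> \<open>Completing the square: \<open>3 (12 a^2 + 8 a) = 4 (3 a + 1)^2 - 4\<close>, so
    equality would give \<open>3 n - 1 = 4 (x^2 + y^2)\<close>.\<close>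
  have sum: "?e a + ?e b \<noteq> int (n - 3)" for a b
    using no1[of "3 * a + 1" "3 * b + 1"] \<open>n \<ge> 3\<close>
    by (auto simp: algebra_simps power2_eq_square of_nat_diff)
  \<comment> \<open>Likewise \<open>3 * 12 d^2 = 4 (3 d)^2\<close>, and the doubled exponent
    produces \<open>2 y^2\<close>.\<close>
  have sum2: "?d d + 2 * ?e a \<noteq> int (n - 3)" for a d
    using no2[of "3 * d" "3 * a + 1"] \<open>n \<ge> 3\<close>
    by (auto simp: algebra_simps power2_eq_square of_nat_diff)
  have "(U_series * U_series) $ (n - 3) = 0" "(U_series * W) $ (n - 3) = 0" "(F * U2) $ (n - 3) = 0"
    unfolding U_series_def W_def F_def U2_def
      index_series_mult[OF fe fe] index_series_mult[OF fd fe2]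
    by (rule index_series_nth_eq_0; use sum sum2 in auto)+
  thus ?thesis using eq by (simp add: power2_eq_square)
qed

text \<open>For the argument \<open>N\<close>,
  \<open>(3 N - 1) / 4 = p^(2 k + 1) (3 n + 2 p)\<close>, where \<open>p\<close> does not divide the
  last factor; neither binary form represents such a number.\<close>

theorem theorem1p2:
  fixes p k :: nat and n :: int
  assumes "prime p" and "[p = 7] (mod 8)" and "\<not> int p dvd n"
  shows "[c5 (4 * int p ^ (2 * k + 1) * n + (8 * int p ^ (2 * k + 2) + 1) div 3) = 0] (mod 4)"
proof -
  let ?N = "4 * int p ^ (2 * k + 1) * n + (8 * int p ^ (2 * k + 2) + 1) div 3"
  let ?m = "3 * n + 2 * int p"
  have p8: "p mod 8 = 7" using assms(2) by (simp add: cong_def)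
  have p4: "p mod 4 = 3" using p8 by presburger
  have P: "prime (int p)" using assms(1) by simp
  have "\<not> int p dvd 3"
  proof
    assume "int p dvd 3"
    hence "int p \<le> 3" by (rule zdvd_imp_le) simp
    hence "p \<le> 3" by simp
    moreover have "p \<ge> 7" using p8 by presburger
    ultimately show False by simp
  qed
  hence m: "\<not> int p dvd ?m"
    using assms(3) P by (simp add: dvd_add_left_iff prime_dvd_mult_iff)
  \<comment> \<open>Since 3 does not divide \<open>p\<close>, even powers of \<open>p\<close> are 1
    modulo 3 and the division by 3 in \<open>?N\<close> is exact.\<close>
  have "\<not> 3 dvd int p"
  proof
    assume "3 dvd int p"
    hence "3 dvd p" using int_dvd_int_iff[of 3 p] by simp
    hence "p = 3" using assms(1) by (auto simp: prime_nat_iff)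
    thus False using \<open>\<not> int p dvd 3\<close> by simp
  qed
  moreover have "q mod 3 = 1 \<or> q mod 3 = 2" if "\<not> 3 dvd q" for q :: int
    using that by presburger
  ultimately have "[int p = 1] (mod 3) \<or> [int p = - 1] (mod 3)"
    by (simp add: cong_def)
  hence "[(int p)\<^sup>2 = 1] (mod 3)"
    using cong_pow[of "int p" 1 3 2] cong_pow[of "int p" "- 1" 3 2] by auto
  hence "[((int p)\<^sup>2) ^ (k + 1) = 1 ^ (k + 1)] (mod 3)" by (rule cong_pow)
  moreover have "((int p)\<^sup>2) ^ (k + 1) = int p ^ (2 * k + 2)"
    by (simp add: power_mult power2_eq_square mult.assoc)
  ultimately have "int p ^ (2 * k + 2) mod 3 = 1" by (simp add: cong_def)
  moreover have "3 * ((8 * q + 1) div 3) = 8 * q + 1" if "q mod 3 = 1" for q :: int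
    using that by presburger
  ultimately have "3 * ((8 * int p ^ (2 * k + 2) + 1) div 3) = 8 * int p ^ (2 * k + 2) + 1" by blast
  hence N: "3 * ?N - 1 = 4 * (int p ^ (2 * k + 1) * ?m)"
    by (simp add: algebra_simps)
  have "[c5 N = 0] (mod 4)" if N: "3 * N - 1 = 4 * (int p ^ (2 * k + 1) * ?m)" for N
  proof (cases "N < 0")
    \<comment> \<open>A negative \<open>n\<close> can make the argument negative; then
      \<open>c5\<close> is 0 by convention.\<close>
    case True
    thus ?thesis by (simp add: c5_def)
  next
    case False
    then obtain M where M: "N = int M" by (metis nonneg_int_cases not_less)
    have "M mod 4 = 3" if "3 * int M - 1 = 4 * t" for t
      using that by presburger
    from this[OF N[unfolded M]] have "M mod 4 = 3" .
    hence "4 dvd c5 (int M)"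
    proof (rule c5_dvd_4)
      fix x y :: int
      have "x\<^sup>2 + 1 * y\<^sup>2 \<noteq> int p ^ (2 * k + 1) * ?m"
        by (rule odd_prime_power_not_represented[OF assms(1) _ m])
           (metis mult_1 prime_dvd_sum_two_squares[OF assms(1) p4])
      thus "3 * int M - 1 \<noteq> 4 * (x\<^sup>2 + y\<^sup>2)"
        unfolding N[unfolded M] by simp
      have "x\<^sup>2 + 2 * y\<^sup>2 \<noteq> int p ^ (2 * k + 1) * ?m"
        by (rule odd_prime_power_not_represented[OF assms(1) _ m])
           (rule prime_dvd_square_plus_twice_square[OF assms(1) p8])
      thus "3 * int M - 1 \<noteq> 4 * (x\<^sup>2 + 2 * y\<^sup>2)"
        unfolding N[unfolded M] by simp
    qed
    thus ?thesis by (simp add: M cong_0_iff)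
  qed
  from this[OF N] show ?thesis .
qed

end
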